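(* Fix $\theta_3\in[0,2\pi)$ and consider the two-parameter qubit model $$\rho_\theta=\frac12\begin{pmatrix}1+\theta_2&\theta_1e^{-i\theta_3}\\ \theta_1e^{i\theta_3}&1-\theta_2\end{pmatrix},\qquad \theta=(\theta_1,\theta_2),\quad \theta_1^2+\theta_2^2<1,\ \theta_1\neq0.$$ Let $C^H_\theta[W]$ be the Holevo bound of this model (with respect to $\theta_1,\theta_2$) and let $$G_\theta^{-1}=\begin{pmatrix}1-\theta_1^2 & -\theta_1\theta_2\\ -\theta_1\theta_2 & 1-\theta_2^2\end{pmatrix}.$$ Then for every real symmetric positive definite $2\times2$ matrix $W$, $$C^H_\theta[W]=\mathrm{Tr}\{WG_\theta^{-1}\},$$ and correspondingly $$\{V\in\mathbb{R}^{2\times2}: V^T=V,\ \mathrm{Tr}\{WV\}\ge C_\theta^H[W]\ \text{ for all } W>0\}=\{V\in\mathbb{R}^{2\times 2}: V^T=V,\ V\ge G_\theta^{-1}\}.$$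
   Context: For a smooth $k$-parameter family of density matrices $\rho_\theta$ on a finite-dimensional Hilbert space, with $\partial_i=\partial/\partial\theta_i$, let $\mathcal{X}_\theta$ be the set of $k$-tuples $\vec X=(X^1,\dots,X^k)$ of Hermitian operators such that $\mathrm{tr}(\rho_\theta X^i)=0$ for all $i$ and $\mathrm{tr}(\partial_i\rho_\theta\, X^j)=\delta_{ij}$ for all $i,j$. Let $Z_\theta[\vec X]$ be the $k\times k$ matrix with $(i,j)$ entry $\mathrm{tr}(\rho_\theta X^jX^i)$. For a real symmetric positive definite $k\times k$ matrix $W$, set $$h_\theta[\vec X|W]=\mathrm{Tr}\{W\,\mathrm{Re}\,Z_\theta[\vec X]\}+\mathrm{TrAbs}\{W\,\mathrm{Im}\,Z_\theta[\vec X]\},$$ where $\mathrm{Re}$ and $\mathrm{Im}$ are taken entrywise and $\mathrm{TrAbs}\{A\}$ is the sum of the absolute values of the eigenvalues of $A$ (with multiplicity). The Holevo bound is $C^H_\theta[W]=\min_{\vec X\in\mathcal{X}_\theta}h_\theta[\vec X|W]$. Here $k=2$. $G_\theta$ is the SLD quantum Fisher information matrix of the model. For symmetric matrices, $A\ge B$ (resp. $A>B$) means that $A-B$ is positive semidefinite (resp. positive definite). *)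

theory Defs
  imports "HOL-Analysis.Analysis" "HOL-Computational_Algebra.Computational_Algebra"
begin

section \<open>Matrix notions\<close>

definition hermitian :: "complex^'n^'n \<Rightarrow> bool" where
  "hermitian A \<longleftrightarrow> (\<forall>i j. A $ i $ j = cnj (A $ j $ i))"

definition pos_semidef :: "real^'k^'k \<Rightarrow> bool" where
  "pos_semidef A \<longleftrightarrow> transpose A = A \<and> (\<forall>x. 0 \<le> x \<bullet> (A *v x))"

definition pos_def :: "real^'k^'k \<Rightarrow> bool" where
  "pos_def A \<longleftrightarrow> transpose A = A \<and> (\<forall>x. x \<noteq> 0 \<longrightarrow> 0 < x \<bullet> (A *v x))"

definition charpoly :: "'a::comm_ring_1^'k^'k \<Rightarrow> 'a poly" where
  "charpoly A = det (mat [:0, 1:] - (\<chi> i j. [:A $ i $ j:]))"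

text \<open>The eigenvalues of a real matrix are taken in the complex numbers, with algebraic
  multiplicity: the product of a symmetric and an antisymmetric real matrix, to which this is
  applied below, typically has no nonzero real eigenvalue.\<close>

definition TrAbs :: "real^'k^'k \<Rightarrow> real" where
  "TrAbs A = (\<Sum>z\<in>#proots (charpoly (\<chi> i j. complex_of_real (A $ i $ j))). cmod z)"

section \<open>Parametric models, SLD Fisher information and the Holevo bound\<close>

definition pderiv_at :: "(real^'k \<Rightarrow> complex^'n^'n) \<Rightarrow> real^'k \<Rightarrow> 'k \<Rightarrow> complex^'n^'n" where
  "pderiv_at \<rho> \<theta> i = vector_derivative (\<lambda>t. \<rho> (\<theta> + t *\<^sub>R axis i 1)) (at 0)"

definition is_sld :: "(real^'k \<Rightarrow> complex^'n^'n) \<Rightarrow> real^'k \<Rightarrow> 'k \<Rightarrow> complex^'n^'n \<Rightarrow> bool" where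
  "is_sld \<rho> \<theta> i L \<longleftrightarrow>
     hermitian L \<and> pderiv_at \<rho> \<theta> i = (1/2) *\<^sub>R (\<rho> \<theta> ** L + L ** \<rho> \<theta>)"

text \<open>The symmetric logarithmic derivative is unique when the state has full rank; otherwise the
  choice does not affect the Fisher information matrix.\<close>

definition sld :: "(real^'k \<Rightarrow> complex^'n^'n) \<Rightarrow> real^'k \<Rightarrow> 'k \<Rightarrow> complex^'n^'n" where
  "sld \<rho> \<theta> i = (SOME L. is_sld \<rho> \<theta> i L)"

definition sld_qfi :: "(real^'k \<Rightarrow> complex^'n^'n) \<Rightarrow> real^'k \<Rightarrow> real^'k^'k" where
  "sld_qfi \<rho> \<theta> = (\<chi> i j. Re (trace (\<rho> \<theta> ** sld \<rho> \<theta> i ** sld \<rho> \<theta> j)))"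

definition locally_unbiased ::
  "(real^'k \<Rightarrow> complex^'n^'n) \<Rightarrow> real^'k \<Rightarrow> ('k \<Rightarrow> complex^'n^'n) set" where
  "locally_unbiased \<rho> \<theta> = {X. (\<forall>i. hermitian (X i)) \<and> (\<forall>i. trace (\<rho> \<theta> ** X i) = 0) \<and>
     (\<forall>i j. trace (pderiv_at \<rho> \<theta> i ** X j) = (if i = j then 1 else 0))}"

definition Z_matrix ::
  "(real^'k \<Rightarrow> complex^'n^'n) \<Rightarrow> real^'k \<Rightarrow> ('k \<Rightarrow> complex^'n^'n) \<Rightarrow> complex^'k^'k" where
  "Z_matrix \<rho> \<theta> X = (\<chi> i j. trace (\<rho> \<theta> ** X j ** X i))"

definition holevo_fun ::
  "(real^'k \<Rightarrow> complex^'n^'n) \<Rightarrow> real^'k \<Rightarrow> real^'k^'k \<Rightarrow> ('k \<Rightarrow> complex^'n^'n) \<Rightarrow> real" where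
  "holevo_fun \<rho> \<theta> W X =
     trace (W ** (\<chi> i j. Re (Z_matrix \<rho> \<theta> X $ i $ j))) +
     TrAbs (W ** (\<chi> i j. Im (Z_matrix \<rho> \<theta> X $ i $ j)))"

text \<open>\<^const>\<open>Least\<close> is the minimum of the set whenever the minimum exists, and unspecified
  otherwise.\<close>

definition holevo_bound ::
  "(real^'k \<Rightarrow> complex^'n^'n) \<Rightarrow> real^'k \<Rightarrow> real^'k^'k \<Rightarrow> real" where
  "holevo_bound \<rho> \<theta> W = (LEAST c. c \<in> holevo_fun \<rho> \<theta> W ` locally_unbiased \<rho> \<theta>)"

section \<open>The two-parameter qubit model\<close>

definition qubit_model :: "real \<Rightarrow> real^2 \<Rightarrow> complex^2^2" where
  "qubit_model \<theta>\<^sub>3 \<theta> = (1/2) *\<^sub>R vector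
     [vector [1 + of_real (\<theta> $ 2), of_real (\<theta> $ 1) * exp (- \<i> * of_real \<theta>\<^sub>3)],
      vector [of_real (\<theta> $ 1) * exp (\<i> * of_real \<theta>\<^sub>3), 1 - of_real (\<theta> $ 2)]]"

end

theory Submission
  imports Defs
begin

text \<open>In the Bloch frame with axes \<open>n\<^sub>1 = (cos \<theta>\<^sub>3, sin \<theta>\<^sub>3, 0)\<close>, \<open>n\<^sub>2 = (0, 0, 1)\<close> and \<open>n\<^sub>3\<close> orthogonal
  to both, local unbiasedness leaves only the \<open>n\<^sub>3\<close>-components \<open>s\<^sub>1\<close>, \<open>s\<^sub>2\<close> of \<open>X\<^sup>1\<close>, \<open>X\<^sup>2\<close> free, and
  \<open>Re Z = G\<^sup>-\<^sup>1 + s s\<^sup>T\<close>. Since \<open>W\<close> is positive definite and \<open>TrAbs\<close> is nonnegative, the Holevo function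
  is at least \<open>Tr (W G\<^sup>-\<^sup>1)\<close>. At \<open>s = 0\<close> the observables and the state lie in one Bloch plane, so that
  \<open>Im Z = 0\<close> and the bound is attained.\<close>

section \<open>Two-by-two matrices and self-duality of the semidefinite cone\<close>

lemma trace_2: "trace (A :: 'a::semiring_1^2^2) = A $ 1 $ 1 + A $ 2 $ 2"
  by (simp add: trace_def sum_2)

lemma matrix_mult_2_nth:
  "((A :: 'a::semiring_1^2^2) ** B) $ i $ j = A $ i $ 1 * B $ 1 $ j + A $ i $ 2 * B $ 2 $ j"
  by (simp add: matrix_matrix_mult_def sum_2)

lemma inner_mult_vec_2:
  fixes A :: "real^2^2"
  shows "x \<bullet> (A *v x) = A $ 1 $ 1 * (x $ 1)\<^sup>2 + (A $ 1 $ 2 + A $ 2 $ 1) * (x $ 1 * x $ 2) + A $ 2 $ 2 * (x $ 2)\<^sup>2"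
  by (simp add: inner_vec_def matrix_vector_mult_def sum_2 power2_eq_square algebra_simps)

lemma transpose_eq_2:
  "transpose (A :: 'a^2^2) = A \<longleftrightarrow> A $ 1 $ 2 = A $ 2 $ 1"
  by (auto simp: vec_eq_iff transpose_def forall_2)

lemma TrAbs_nonneg: "0 \<le> TrAbs A"
  unfolding TrAbs_def using sum_mset_mono[where f = "\<lambda>_. 0 :: real" and g = cmod] by simp

text \<open>Serves the minimizer \<open>s = 0\<close>, where \<open>Im Z\<close> vanishes: the
  characteristic polynomial is the square of the indeterminate, so both roots are 0.\<close>

lemma TrAbs_zero_2: "TrAbs (0 :: real^2^2) = 0"
proof -
  have "charpoly (\<chi> i j. complex_of_real ((0 :: real^2^2) $ i $ j)) = [:0, 1:] ^ 2"
    by (simp add: charpoly_def det_2 mat_def power2_eq_square)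
  moreover have "proots ([:0, 1:] :: complex poly) = {#0#}"
    using proots_linear_factor[of "0 :: complex"] by simp
  ultimately show ?thesis
    by (simp add: TrAbs_def proots_power)
qed

lemma pos_def_imp_pos_semidef: "pos_def A \<Longrightarrow> pos_semidef A"
  unfolding pos_def_def pos_semidef_def
  by (metis inner_zero_left less_imp_le order_refl)

lemma trace_mult_nonneg_2:
  fixes W D :: "real^2^2"
  assumes W: "pos_def W" and D: "pos_semidef D"
  shows "0 \<le> trace (W ** D)"
proof -
  define p q r where "p = W $ 1 $ 1" and "q = W $ 1 $ 2" and "r = W $ 2 $ 2"
  have sW: "W $ 2 $ 1 = q" and sD: "D $ 2 $ 1 = D $ 1 $ 2"
    using W D by (auto simp: pos_def_def pos_semidef_def transpose_eq_2 q_def)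
  have posW: "0 < p * (x $ 1)\<^sup>2 + (q + q) * (x $ 1 * x $ 2) + r * (x $ 2)\<^sup>2" if "x \<noteq> 0" for x :: "real^2"
    using W that by (auto simp: pos_def_def inner_mult_vec_2 sW simp flip: p_def q_def r_def)
  have posD: "0 \<le> D $ 1 $ 1 * (x $ 1)\<^sup>2 + 2 * D $ 1 $ 2 * (x $ 1 * x $ 2) + D $ 2 $ 2 * (x $ 2)\<^sup>2" for x :: "real^2"
    using D by (auto simp: pos_semidef_def inner_mult_vec_2 sD)
  have p: "0 < p"
    using posW[of "vector [1, 0]"] by (auto simp: vec_eq_iff forall_2)
  \<comment> \<open>This vector minimizes the quadratic form of \<open>W\<close> among those with
    second coordinate 1; the minimum is the Schur complement
    \<open>r - q\<^sup>2 / p\<close>.\<close>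
  have "vector [- q / p, 1] \<noteq> (0 :: real^2)"
    by (simp add: vec_eq_iff forall_2)
  from posW[OF this] have "0 < r - q\<^sup>2 / p"
    using p by (simp add: field_simps power2_eq_square)
  moreover have "0 \<le> D $ 2 $ 2"
    using posD[of "vector [0, 1]"] by simp
  moreover have "0 \<le> D $ 1 $ 1 + 2 * D $ 1 $ 2 * (q / p) + D $ 2 $ 2 * (q / p)\<^sup>2"
    using posD[of "vector [1, q / p]"] by simp
  \<comment> \<open>\<open>W = p v v\<^sup>T + (r - q\<^sup>2/p) e\<^sub>2 e\<^sub>2\<^sup>T\<close> with \<open>v = (1, q/p)\<close>\<close>
  moreover have "trace (W ** D) =
      p * (D $ 1 $ 1 + 2 * D $ 1 $ 2 * (q / p) + D $ 2 $ 2 * (q / p)\<^sup>2) + (r - q\<^sup>2 / p) * D $ 2 $ 2"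
    using p by (simp add: trace_2 matrix_mult_2_nth sW sD field_simps power2_eq_square
        flip: p_def q_def r_def)
  ultimately show ?thesis
    using p by (metis add_nonneg_nonneg less_imp_le mult_nonneg_nonneg)
qed

text \<open>Self-duality of the semidefinite cone, tested on its interior only. It turns a family of
  weighted trace inequalities into one matrix inequality.\<close>

lemma pos_semidef_iff_trace_mult_nonneg_2:
  fixes D :: "real^2^2"
  assumes sym: "transpose D = D"
  shows "pos_semidef D \<longleftrightarrow> (\<forall>W. pos_def W \<longrightarrow> 0 \<le> trace (W ** D))"
proof
  assume "\<forall>W. pos_def W \<longrightarrow> 0 \<le> trace (W ** D)"
  then have nonneg: "0 \<le> trace (W ** D)" if "pos_def W" for W
    using that by blast
  have "0 \<le> x \<bullet> (D *v x)" for x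
  proof -
    have "0 \<le> x \<bullet> (D *v x) + e * trace D" if e: "0 < e" for e
    proof -
      \<comment> \<open>The natural test matrix x x^T is singular, hence not an admissible weight.
        Adding e times the identity makes it positive definite, and e tends to 0 from the right
        below.\<close>
      define W :: "real^2^2" where
        "W = (\<chi> i j. x $ i * x $ j + (if i = j then e else 0))"
      have W_form: "y \<bullet> (W *v y) = (x \<bullet> y)\<^sup>2 + e * (y \<bullet> y)" for y
        by (simp add: inner_mult_vec_2 W_def, simp add: inner_vec_def sum_2 power2_eq_square algebra_simps)
      have "pos_def W"
        unfolding pos_def_def W_form
        using e by (auto simp: transpose_eq_2 W_def intro!: add_nonneg_pos)
      moreover have "trace (W ** D) = x \<bullet> (D *v x) + e * trace D"
        by (simp add: trace_2 matrix_mult_2_nth W_def inner_mult_vec_2 power2_eq_square algebra_simps)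
      ultimately show ?thesis
        using nonneg by metis
    qed
    then have "\<forall>\<^sub>F e in at_right 0. 0 \<le> x \<bullet> (D *v x) + e * trace D"
      by (auto simp: eventually_at_right_field intro!: exI[of _ 1])
    moreover have "((\<lambda>e. x \<bullet> (D *v x) + e * trace D) \<longlongrightarrow> x \<bullet> (D *v x) + 0 * trace D) (at_right 0)"
      by (intro tendsto_intros)
    ultimately show ?thesis
      using tendsto_lowerbound by fastforce
  qed
  then show "pos_semidef D"
    using sym by (simp add: pos_semidef_def)
qed (auto intro: trace_mult_nonneg_2)

lemma matrix_inv_eqI:
  fixes A B :: "'a::field^'n^'n"
  assumes "A ** B = mat 1"
  shows "invertible A" and "matrix_inv A = B"
proof -
  have BA: "B ** A = mat 1"
    using assms matrix_left_right_inverse by blast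
  then show inv: "invertible A"
    using assms invertible_def by blast
  \<comment> \<open>\<open>matrix_inv\<close> is a Hilbert choice, so every candidate has to be
    identified with \<open>B\<close>.\<close>
  have "C = B" if "C ** A = mat 1" for C
    using that assms by (metis matrix_mul_assoc matrix_mul_lid matrix_mul_rid)
  then show "matrix_inv A = B"
    unfolding matrix_inv_def using assms BA by (blast intro: some_equality)
qed


section \<open>Bloch coordinates in the rotated frame\<close>

text \<open>For \<open>|u| = 1\<close>, the coordinates \<open>x\<close>, \<open>y\<close>, \<open>z\<close> refer to the Bloch axes \<open>(Re u, Im u, 0)\<close>,
  \<open>(- Im u, Re u, 0)\<close> and \<open>(0, 0, 1)\<close>.\<close>

definition bloch :: "complex \<Rightarrow> real \<Rightarrow> real \<Rightarrow> real \<Rightarrow> real \<Rightarrow> complex^2^2" where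
  "bloch u p x y z = vector
     [vector [of_real (p + z), Complex x (- y) * cnj u],
      vector [Complex x y * u, of_real (p - z)]]"

lemma bloch_nth [simp]:
  "bloch u p x y z $ 1 $ 1 = of_real (p + z)"
  "bloch u p x y z $ 1 $ 2 = Complex x (- y) * cnj u"
  "bloch u p x y z $ 2 $ 1 = Complex x y * u"
  "bloch u p x y z $ 2 $ 2 = of_real (p - z)"
  by (simp_all add: bloch_def)

lemma hermitian_bloch: "hermitian (bloch u p x y z)"
  by (simp add: hermitian_def forall_2 complex_eq_iff)

lemma hermitian_eq_bloch:
  assumes A: "hermitian A" and u: "u * cnj u = 1"
  obtains p x y z where "A = bloch u p x y z"
proof
  have u': "cnj u * u = 1"
    using u by (simp add: mult.commute)
  \<comment> \<open>Inserting \<open>cnj u * u\<close> splits off the phase; the remaining factor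
    \<open>A $ 2 $ 1 * cnj u\<close> carries the coordinates \<open>x\<close> and
    \<open>y\<close>.\<close>
  have "A $ 2 $ 1 = A $ 2 $ 1 * (cnj u * u)"
    by (simp add: u')
  then have A21: "A $ 2 $ 1 = A $ 2 $ 1 * cnj u * u"
    by (simp only: mult.assoc)
  have A12: "A $ 1 $ 2 = cnj (A $ 2 $ 1)"
    and "A $ 1 $ 1 = cnj (A $ 1 $ 1)" "A $ 2 $ 2 = cnj (A $ 2 $ 2)"
    using A unfolding hermitian_def by blast+
  then have "Im (A $ 1 $ 1) = 0" "Im (A $ 2 $ 2) = 0"
    by (simp_all add: complex_eq_iff)
  moreover have "Complex (Re w) (- Im w) = cnj w" for w
    by (simp add: complex_eq_iff)
  moreover have "A $ 1 $ 2 = cnj (A $ 2 $ 1 * cnj u) * cnj u"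
    using A12 A21 by (metis complex_cnj_mult)
  ultimately show "A = bloch u ((Re (A $ 1 $ 1) + Re (A $ 2 $ 2)) / 2)
      (Re (A $ 2 $ 1 * cnj u)) (Im (A $ 2 $ 1 * cnj u)) ((Re (A $ 1 $ 1) - Re (A $ 2 $ 2)) / 2)"
    using A21 by (simp add: vec_eq_iff forall_2 complex_eq_iff field_simps del: complex_cnj_mult)
qed

lemma bloch_eq_iff:
  assumes "u * cnj u = 1"
  shows "bloch u p x y z = bloch u p' x' y' z' \<longleftrightarrow> p = p' \<and> x = x' \<and> y = y' \<and> z = z'"
proof -
  have "u \<noteq> 0"
    using assms by auto
  then show ?thesis
    by (auto simp: vec_eq_iff forall_2 of_real_eq_iff simp del: of_real_add of_real_diff)
qed

lemma bloch_add:
  "bloch u p x y z + bloch u p' x' y' z' = bloch u (p + p') (x + x') (y + y') (z + z')"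
  by (simp add: vec_eq_iff forall_2 complex_eq_iff algebra_simps)

lemma scaleR_bloch:
  "c *\<^sub>R bloch u p x y z = bloch u (c * p) (c * x) (c * y) (c * z)"
  by (simp add: vec_eq_iff forall_2 complex_eq_iff algebra_simps)

text \<open>The phases cancel on the diagonal and stay as a single factor off it, so one further
  multiplication cancels them in the trace of a triple product.\<close>

lemma bloch_mult_nth:
  assumes u: "u * cnj u = 1"
  shows "(bloch u p x y z ** bloch u p' x' y' z') $ 1 $ 1 =
           of_real ((p + z) * (p' + z')) + Complex x (- y) * Complex x' y'" (is ?a)
    and "(bloch u p x y z ** bloch u p' x' y' z') $ 1 $ 2 =
           (of_real (p + z) * Complex x' (- y') + of_real (p' - z') * Complex x (- y)) * cnj u" (is ?b)
    and "(bloch u p x y z ** bloch u p' x' y' z') $ 2 $ 1 =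
           (of_real (p' + z') * Complex x y + of_real (p - z) * Complex x' y') * u" (is ?c)
    and "(bloch u p x y z ** bloch u p' x' y' z') $ 2 $ 2 =
           of_real ((p - z) * (p' - z')) + Complex x y * Complex x' (- y')" (is ?d)
proof -
  have *: "v * cnj u * (w * u) = v * w" "v * u * (w * cnj u) = v * w" for v w
    using u by (auto simp: mult_ac)
  show ?a ?d
    by (simp_all add: matrix_mult_2_nth *)
  show ?b ?c
    by (simp_all add: matrix_mult_2_nth algebra_simps)
qed

lemma trace_bloch_mult:
  assumes "u * cnj u = 1"
  shows "trace (bloch u p x y z ** bloch u p' x' y' z') = of_real (2 * (p * p' + x * x' + y * y' + z * z'))"
  by (simp add: trace_2 bloch_mult_nth[OF assms] complex_eq_iff algebra_simps)

lemma bloch_anticommutator: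
  assumes "u * cnj u = 1"
  shows "bloch u p x y z ** bloch u p' x' y' z' + bloch u p' x' y' z' ** bloch u p x y z =
    bloch u (2 * (p * p' + x * x' + y * y' + z * z'))
      (2 * (p * x' + p' * x)) (2 * (p * y' + p' * y)) (2 * (p * z' + p' * z))"
  by (simp add: vec_eq_iff forall_2 bloch_mult_nth[OF assms] complex_eq_iff algebra_simps)

text \<open>The imaginary part is twice the scalar triple product of the three Bloch vectors, so it
  vanishes when they are coplanar.\<close>

lemma trace_bloch_mult3:
  assumes u: "u * cnj u = 1"
  shows "trace (bloch u p0 x0 y0 z0 ** bloch u p x y z ** bloch u p' x' y' z') =
    Complex (2 * (p0 * (p * p' + x * x' + y * y' + z * z') +
        x0 * (p * x' + p' * x) + y0 * (p * y' + p' * y) + z0 * (p * z' + p' * z)))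
      (2 * (x0 * (y * z' - z * y') + y0 * (z * x' - x * z') + z0 * (x * y' - y * x')))"
proof -
  have *: "v * cnj u * (w * u) = v * w" "v * u * (w * cnj u) = v * w" for v w
    using u by (auto simp: mult_ac)
  show ?thesis
    unfolding trace_2 matrix_mult_2_nth[of "_ ** _"] bloch_mult_nth[OF u] bloch_nth *
    by (simp add: complex_eq_iff algebra_simps)
qed


section \<open>The qubit model\<close>

lemma cis_mult_cnj: "cis t * cnj (cis t) = 1"
  by (simp add: cis_cnj cis_mult)

text \<open>Choosing \<open>u = cis t\<close> absorbs the fixed phase into the frame: the state has
  no \<open>y\<close>-component, and \<open>t\<close> drops out of the coordinates.\<close>

lemma qubit_model_bloch:
  "qubit_model t \<theta> = bloch (cis t) (1/2) (\<theta> $ 1 / 2) 0 (\<theta> $ 2 / 2)"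
proof -
  have "exp (\<i> * of_real t) = cis t" "exp (- \<i> * of_real t) = cnj (cis t)"
    by (simp_all add: cis_conv_exp exp_cnj)
  then show ?thesis
    unfolding qubit_model_def
    by (simp add: vec_eq_iff forall_2 complex_eq_iff)
qed

definition tangent :: "real \<Rightarrow> 2 \<Rightarrow> complex^2^2" where
  "tangent t i = bloch (cis t) 0 (if i = 1 then 1/2 else 0) 0 (if i = 2 then 1/2 else 0)"

text \<open>The model is affine in \<theta>, so its derivative does not depend on the point.\<close>

lemma pderiv_qubit_model: "pderiv_at (qubit_model t) \<theta> i = tangent t i"
proof -
  have "qubit_model t (\<theta> + s *\<^sub>R axis i 1) = qubit_model t \<theta> + s *\<^sub>R tangent t i" for s
    unfolding qubit_model_bloch tangent_def scaleR_bloch bloch_add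
    by (auto simp: bloch_eq_iff[OF cis_mult_cnj] axis_def field_simps)
  moreover have "((\<lambda>s. qubit_model t \<theta> + s *\<^sub>R tangent t i) has_vector_derivative tangent t i) (at 0)"
    by (auto intro!: derivative_eq_intros)
  ultimately show ?thesis
    unfolding pderiv_at_def by (simp add: vector_derivative_at)
qed

text \<open>In Bloch coordinates the SLD equation is a linear system. Eliminating the vector part
  leaves the scalar part times 1 - |\<theta>|^2 equal to \<open>- (\<theta> $ i)\<close>, which has
  one solution inside the Bloch ball. Uniqueness pins down the choice made by
  \<open>sld\<close>.\<close>

lemma is_sld_qubit_model_iff:
  fixes \<theta> :: "real^2"
  assumes "(\<theta> $ 1)\<^sup>2 + (\<theta> $ 2)\<^sup>2 < 1"
  defines "p \<equiv> \<lambda>i. - (\<theta> $ i) / (1 - (\<theta> $ 1)\<^sup>2 - (\<theta> $ 2)\<^sup>2)"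
  shows "is_sld (qubit_model t) \<theta> i L \<longleftrightarrow>
    L = bloch (cis t) (p i) ((if i = 1 then 1 else 0) - p i * \<theta> $ 1) 0
          ((if i = 2 then 1 else 0) - p i * \<theta> $ 2)" (is "_ \<longleftrightarrow> L = ?L")
proof -
  note u = cis_mult_cnj[of t]
  define N where "N = 1 - (\<theta> $ 1)\<^sup>2 - (\<theta> $ 2)\<^sup>2"
  have N: "N \<noteq> 0"
    using assms by (simp add: N_def)
  have p: "p i * N = - (\<theta> $ i)"
    using N by (simp add: p_def flip: N_def)
  have i: "i = 1 \<or> i = 2"
    using exhaust_2 by auto
  have *: "is_sld (qubit_model t) \<theta> i (bloch (cis t) q x y z) \<longleftrightarrow>
      q + \<theta> $ 1 * x + \<theta> $ 2 * z = 0 \<and> x + q * \<theta> $ 1 = (if i = 1 then 1 else 0) \<and>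
      y = 0 \<and> z + q * \<theta> $ 2 = (if i = 2 then 1 else 0)" for q x y z
    unfolding is_sld_def pderiv_qubit_model qubit_model_bloch tangent_def
      bloch_anticommutator[OF u] scaleR_bloch bloch_eq_iff[OF u]
    by (auto simp: hermitian_bloch field_simps)
  show ?thesis
  proof
    assume L: "is_sld (qubit_model t) \<theta> i L"
    then obtain q x y z where Leq: "L = bloch (cis t) q x y z"
      using hermitian_eq_bloch[OF _ u] is_sld_def by metis
    have eqs: "q + \<theta> $ 1 * x + \<theta> $ 2 * z = 0" "x = (if i = 1 then 1 else 0) - q * \<theta> $ 1"
      "y = 0" "z = (if i = 2 then 1 else 0) - q * \<theta> $ 2"
      using L unfolding Leq * by linarith+
    have "q * N = - (\<theta> $ i)"
      using i eqs by (auto simp: N_def power2_eq_square algebra_simps)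
    then have "q = p i"
      using p N by (metis mult_cancel_right)
    then show "L = ?L"
      using eqs Leq by simp
  next
    assume "L = ?L"
    moreover have "p i + \<theta> $ 1 * ((if i = 1 then 1 else 0) - p i * \<theta> $ 1) +
        \<theta> $ 2 * ((if i = 2 then 1 else 0) - p i * \<theta> $ 2) = 0"
      using i p by (auto simp: N_def power2_eq_square algebra_simps)
    ultimately show "is_sld (qubit_model t) \<theta> i L"
      by (simp add: *)
  qed
qed

definition inv_qfi :: "real^2 \<Rightarrow> real^2^2" where
  "inv_qfi \<theta> = (\<chi> i j. (if i = j then 1 else 0) - \<theta> $ i * \<theta> $ j)"

text \<open>A Sherman-Morrison pair: with N = 1 - |\<theta>|^2, the Fisher matrix is I + \<theta>
  \<theta>^T / N and \<open>inv_qfi \<theta>\<close> is I - \<theta> \<theta>^T.\<close>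

lemma sld_qfi_qubit_model:
  fixes \<theta> :: "real^2"
  assumes "(\<theta> $ 1)\<^sup>2 + (\<theta> $ 2)\<^sup>2 < 1"
  shows "sld_qfi (qubit_model t) \<theta> ** inv_qfi \<theta> = mat 1"
proof -
  define N where "N = 1 - (\<theta> $ 1)\<^sup>2 - (\<theta> $ 2)\<^sup>2"
  have N: "N \<noteq> 0"
    using assms by (simp add: N_def)
  have sld: "sld (qubit_model t) \<theta> i = bloch (cis t) (- (\<theta> $ i) / N)
      ((if i = 1 then 1 else 0) - - (\<theta> $ i) / N * \<theta> $ 1) 0
      ((if i = 2 then 1 else 0) - - (\<theta> $ i) / N * \<theta> $ 2)" for i
    unfolding sld_def N_def by (rule some_equality) (simp_all only: is_sld_qubit_model_iff[OF assms])
  have G: "sld_qfi (qubit_model t) \<theta> $ i $ j = (if i = j then 1 else 0) + \<theta> $ i * \<theta> $ j / N" for i j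
  proof -
    define p where "p i = - (\<theta> $ i) / N" for i
    have ij: "i = 1 \<or> i = 2" "j = 1 \<or> j = 2"
      using exhaust_2 by auto
    have "sld_qfi (qubit_model t) \<theta> $ i $ j = (if i = j then 1 else 0) + p i * p j * N"
      unfolding sld_qfi_def vec_lambda_beta sld p_def[symmetric]
      unfolding qubit_model_bloch
        trace_bloch_mult3[OF cis_mult_cnj] N_def using ij
      by (elim disjE) (simp_all add: power2_eq_square algebra_simps)
    then show ?thesis
      using N by (simp add: p_def)
  qed
  \<comment> \<open>Naming the reciprocal of \<open>N\<close> keeps the product polynomial; its
    deviation from the identity then carries the factor \<open>c * N - 1\<close>.\<close>
  obtain c where c: "c * N = 1"
    using N by (metis left_inverse)
  have G': "sld_qfi (qubit_model t) \<theta> $ i $ j = (if i = j then 1 else 0) + c * \<theta> $ i * \<theta> $ j" for i j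
    using N c by (simp add: G field_simps)
  have "(sld_qfi (qubit_model t) \<theta> ** inv_qfi \<theta>) $ i $ j =
      (if i = j then 1 else 0) + \<theta> $ i * \<theta> $ j * (c * N - 1)" for i j
  proof -
    have ij: "i = 1 \<or> i = 2" "j = 1 \<or> j = 2"
      using exhaust_2 by auto
    show ?thesis
      unfolding matrix_mult_2_nth G' inv_qfi_def vec_lambda_beta N_def using ij
      by (elim disjE) (simp_all add: power2_eq_square algebra_simps)
  qed
  then show ?thesis
    by (simp add: c vec_eq_iff mat_def)
qed

section \<open>Locally unbiased observables and minimization of the Holevo function\<close>

lemma locally_unbiased_qubit_model:
  "X \<in> locally_unbiased (qubit_model t) \<theta> \<longleftrightarrow>
    (\<exists>s. X = (\<lambda>i. bloch (cis t) (- (\<theta> $ i)) (if i = 1 then 1 else 0) (s $ i) (if i = 2 then 1 else 0)))"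
  (is "_ \<longleftrightarrow> (\<exists>s. X = ?X s)")
proof
  note u = cis_mult_cnj[of t]
  assume X: "X \<in> locally_unbiased (qubit_model t) \<theta>"
  have "\<exists>s. X i = bloch (cis t) (- (\<theta> $ i)) (if i = 1 then 1 else 0) s (if i = 2 then 1 else 0)" for i
  proof -
    have "hermitian (X i)"
      using X by (simp add: locally_unbiased_def)
    then obtain p x y z where Xi: "X i = bloch (cis t) p x y z"
      using hermitian_eq_bloch[OF _ u] by metis
    have "trace (qubit_model t \<theta> ** X i) = 0"
      "trace (tangent t 1 ** X i) = (if i = 1 then 1 else 0)"
      "trace (tangent t 2 ** X i) = (if i = 2 then 1 else 0)"
      using X by (auto simp: locally_unbiased_def pderiv_qubit_model)
    \<comment> \<open>The state and both tangents have zero \<open>y\<close>-component, so the trace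
      conditions fix \<open>p\<close>, \<open>x\<close> and \<open>z\<close> but never see
      \<open>y\<close>.\<close>
    then have "p + \<theta> $ 1 * x + \<theta> $ 2 * z = 0" "x = (if i = 1 then 1 else 0)" "z = (if i = 2 then 1 else 0)"
      unfolding Xi qubit_model_bloch tangent_def trace_bloch_mult[OF u]
      by (auto simp: complex_eq_iff split: if_splits)
    then have "p = - (\<theta> $ i)" "x = (if i = 1 then 1 else 0)" "z = (if i = 2 then 1 else 0)"
      using exhaust_2[of i] by auto
    then show ?thesis
      using Xi by blast
  qed
  then obtain s where "X i = bloch (cis t) (- (\<theta> $ i)) (if i = 1 then 1 else 0) (s i) (if i = 2 then 1 else 0)" for i
    by metis
  then have "X = ?X (\<chi> i. s i)"
    by auto
  then show "\<exists>s. X = ?X s" ..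
next
  note u = cis_mult_cnj[of t]
  assume "\<exists>s. X = ?X s"
  then obtain s where X: "X = ?X s" ..
  show "X \<in> locally_unbiased (qubit_model t) \<theta>"
    unfolding X
    by (simp add: locally_unbiased_def hermitian_bloch pderiv_qubit_model qubit_model_bloch tangent_def
        trace_bloch_mult[OF u] forall_2)
qed

text \<open>In the real part, the scalar components contribute \<theta>_i \<theta>_j and their cross
  terms with the state contribute -2 \<theta>_i \<theta>_j. For \<open>s = 0\<close> all Bloch
  vectors lie in the plane \<open>y = 0\<close>, so the triple product vanishes.\<close>

lemma Z_matrix_qubit_model:
  fixes \<theta> s :: "real^2" and t :: real
  defines "X \<equiv> \<lambda>i. bloch (cis t) (- (\<theta> $ i)) (if i = 1 then 1 else 0) (s $ i) (if i = 2 then 1 else 0)"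
  shows "Re (Z_matrix (qubit_model t) \<theta> X $ i $ j) = inv_qfi \<theta> $ i $ j + s $ i * s $ j"
    and "s = 0 \<Longrightarrow> Im (Z_matrix (qubit_model t) \<theta> X $ i $ j) = 0"
proof -
  have ij: "i = 1 \<or> i = 2" "j = 1 \<or> j = 2"
    using exhaust_2 by auto
  show "Re (Z_matrix (qubit_model t) \<theta> X $ i $ j) = inv_qfi \<theta> $ i $ j + s $ i * s $ j"
    using ij by (auto simp: Z_matrix_def X_def qubit_model_bloch trace_bloch_mult3[OF cis_mult_cnj]
        inv_qfi_def algebra_simps)
  show "Im (Z_matrix (qubit_model t) \<theta> X $ i $ j) = 0" if "s = 0"
    using that by (simp add: Z_matrix_def X_def qubit_model_bloch trace_bloch_mult3[OF cis_mult_cnj])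
qed

text \<open>Attainment and lower bound are separate, since together they give both a minimizer and
  the value of the \<open>LEAST\<close> in \<open>holevo_bound\<close>.\<close>

lemma holevo_fun_qubit_model_min:
  assumes W: "pos_def W"
  shows "\<exists>X \<in> locally_unbiased (qubit_model t) \<theta>. holevo_fun (qubit_model t) \<theta> W X = trace (W ** inv_qfi \<theta>)"
    and "Y \<in> locally_unbiased (qubit_model t) \<theta> \<Longrightarrow>
      trace (W ** inv_qfi \<theta>) \<le> holevo_fun (qubit_model t) \<theta> W Y"
proof -
  let ?X = "\<lambda>s::real^2. \<lambda>i. bloch (cis t) (- (\<theta> $ i)) (if i = 1 then 1 else 0) (s $ i) (if i = 2 then 1 else 0)"
  \<comment> \<open>The term s s^T of \<open>Re Z\<close> contributes the quadratic form of
    \<open>W\<close> at \<open>s\<close>.\<close>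
  have h: "holevo_fun (qubit_model t) \<theta> W (?X s) = trace (W ** inv_qfi \<theta>) + s \<bullet> (W *v s) +
      TrAbs (W ** (\<chi> i j. Im (Z_matrix (qubit_model t) \<theta> (?X s) $ i $ j)))" for s
    unfolding holevo_fun_def Z_matrix_qubit_model(1)
    by (simp add: trace_2 matrix_mult_2_nth inner_mult_vec_2 power2_eq_square algebra_simps)
  have "holevo_fun (qubit_model t) \<theta> W (?X 0) = trace (W ** inv_qfi \<theta>)"
  proof -
    have "(\<chi> i j. Im (Z_matrix (qubit_model t) \<theta> (?X 0) $ i $ j)) = 0"
      by (simp only: Z_matrix_qubit_model(2)) (simp add: vec_eq_iff)
    then show ?thesis
      unfolding h by (simp add: TrAbs_zero_2)
  qed
  then show "\<exists>X \<in> locally_unbiased (qubit_model t) \<theta>.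
      holevo_fun (qubit_model t) \<theta> W X = trace (W ** inv_qfi \<theta>)"
    using locally_unbiased_qubit_model by blast
  assume "Y \<in> locally_unbiased (qubit_model t) \<theta>"
  then obtain s where Y: "Y = ?X s"
    using locally_unbiased_qubit_model by metis
  have "0 \<le> s \<bullet> (W *v s)"
    using pos_def_imp_pos_semidef[OF W] by (simp add: pos_semidef_def)
  then show "trace (W ** inv_qfi \<theta>) \<le> holevo_fun (qubit_model t) \<theta> W Y"
    unfolding Y h by (simp add: TrAbs_nonneg)
qed

lemma holevo_bound_qubit_model:
  assumes W: "pos_def W"
  shows "holevo_bound (qubit_model t) \<theta> W = trace (W ** inv_qfi \<theta>)"
  unfolding holevo_bound_def
proof (rule Least_equality)
  show "trace (W ** inv_qfi \<theta>) \<in> holevo_fun (qubit_model t) \<theta> W ` locally_unbiased (qubit_model t) \<theta>"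
    using holevo_fun_qubit_model_min(1)[OF W] by (metis imageI)
next
  fix c
  assume "c \<in> holevo_fun (qubit_model t) \<theta> W ` locally_unbiased (qubit_model t) \<theta>"
  then show "trace (W ** inv_qfi \<theta>) \<le> c"
    using holevo_fun_qubit_model_min(2)[OF W] by blast
qed

theorem mainTheorem4:
  fixes \<theta>\<^sub>3 :: real and \<theta> :: "real^2"
  assumes "0 \<le> \<theta>\<^sub>3" and "\<theta>\<^sub>3 < 2 * pi"
    and "(\<theta> $ 1)\<^sup>2 + (\<theta> $ 2)\<^sup>2 < 1" and "\<theta> $ 1 \<noteq> 0"
  shows "let \<rho> = qubit_model \<theta>\<^sub>3;
             G = sld_qfi \<rho> \<theta>;
             Ginv = (vector [vector [1 - (\<theta> $ 1)\<^sup>2, - (\<theta> $ 1 * \<theta> $ 2)],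
                             vector [- (\<theta> $ 1 * \<theta> $ 2), 1 - (\<theta> $ 2)\<^sup>2]] :: real^2^2)
         in invertible G \<and> matrix_inv G = Ginv \<and>
            (\<forall>W. pos_def W \<longrightarrow>
               (\<exists>X \<in> locally_unbiased \<rho> \<theta>. \<forall>Y \<in> locally_unbiased \<rho> \<theta>.
                  holevo_fun \<rho> \<theta> W X \<le> holevo_fun \<rho> \<theta> W Y) \<and>
               holevo_bound \<rho> \<theta> W = trace (W ** Ginv)) \<and>
            {V. transpose V = V \<and> (\<forall>W. pos_def W \<longrightarrow> trace (W ** V) \<ge> holevo_bound \<rho> \<theta> W)} =
            {V. transpose V = V \<and> pos_semidef (V - Ginv)}"
proof -
  define \<rho> where "\<rho> = qubit_model \<theta>\<^sub>3"
  have Ginv: "vector [vector [1 - (\<theta> $ 1)\<^sup>2, - (\<theta> $ 1 * \<theta> $ 2)],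
      vector [- (\<theta> $ 1 * \<theta> $ 2), 1 - (\<theta> $ 2)\<^sup>2]] = inv_qfi \<theta>"
    by (simp add: vec_eq_iff forall_2 inv_qfi_def power2_eq_square mult.commute)
  have sym: "transpose (inv_qfi \<theta>) = inv_qfi \<theta>"
    by (simp add: transpose_eq_2 inv_qfi_def mult.commute)
  note G = matrix_inv_eqI[OF sld_qfi_qubit_model[OF assms(3), of \<theta>\<^sub>3], folded \<rho>_def]
  note bound = holevo_bound_qubit_model[of _ \<theta>\<^sub>3 \<theta>, folded \<rho>_def]
  have min: "\<exists>X \<in> locally_unbiased \<rho> \<theta>. \<forall>Y \<in> locally_unbiased \<rho> \<theta>.
      holevo_fun \<rho> \<theta> W X \<le> holevo_fun \<rho> \<theta> W Y" if "pos_def W" for W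
    using holevo_fun_qubit_model_min[OF that, where t = \<theta>\<^sub>3 and \<theta> = \<theta>]
    unfolding \<rho>_def by metis
  \<comment> \<open>By linearity of the trace, the condition says that
    \<open>V - inv_qfi \<theta>\<close> has nonnegative trace against every positive definite
    weight, so self-duality applies.\<close>
  have set_eq: "(\<forall>W. pos_def W \<longrightarrow> trace (W ** V) \<ge> holevo_bound \<rho> \<theta> W) \<longleftrightarrow> pos_semidef (V - inv_qfi \<theta>)"
    if V: "transpose V = V" for V
  proof -
    have "transpose (V - inv_qfi \<theta>) = V - inv_qfi \<theta>"
      using V sym by (simp add: transpose_eq_2)
    moreover have "trace (W ** (V - inv_qfi \<theta>)) = trace (W ** V) - trace (W ** inv_qfi \<theta>)" for W
      by (simp add: trace_2 matrix_mult_2_nth algebra_simps)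
    ultimately show ?thesis
      using pos_semidef_iff_trace_mult_nonneg_2[of "V - inv_qfi \<theta>"] bound by auto
  qed
  from set_eq have "{V. transpose V = V \<and> (\<forall>W. pos_def W \<longrightarrow> trace (W ** V) \<ge> holevo_bound \<rho> \<theta> W)} =
      {V. transpose V = V \<and> pos_semidef (V - inv_qfi \<theta>)}"
    by (intro Collect_cong conj_cong refl)
  then show ?thesis
    unfolding Let_def Ginv \<rho>_def[symmetric]
    by (intro conjI allI impI G min bound)
qed

end
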